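(* Let $t_1<t_2<\cdots<t_n$ be real nodes, let $Q_n(f)=\sum_{i=1}^n\omega_i f(t_i)$ be the interpolatory quadrature rule for $I(f)=\int_a^b f(x)\,w(x)\,dx$ with these nodes, let $\omega=[\omega_1,\ldots,\omega_n]^T$ be its vector of weights, let $\mu_Q$ be its principal moment, and let $Fx=\tilde c$ be its fundamental system ($n+1$ equations in $n$ unknowns). Write $r(x)=Fx-\tilde c$. Then: (a) $\omega$ is the least-squares solution of the fundamental system $Fx=\tilde c$, i.e. the unique minimizer of $\|Fx-\tilde c\|_2$ over $x\in\mathbb{R}^n$. (b) The residual vector $r(\omega)=F\omega-\tilde c$ at the least-squares solution satisfies $$\|r(\omega)\|_\infty=\|r(\omega)\|_p=|\mu_Q|,\qquad p=1,2,\ldots$$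
   Context: Setting. $w$ is a nonnegative weight function, continuous and integrable on the open interval $(a,b)$ and not identically zero, such that $\int_a^b x^i w(x)\,dx$ is finite for $0\le i\le 2n$. The nodes $t_1<\cdots<t_n$ are given real numbers, which may or may not belong to the interval of integration. $\mathcal P_k$ is the space of real polynomials of degree at most $k$. The rule $Q_n$ is interpolatory: $Q_n(p)=I(p)$ for all $p\in\mathcal P_{n-1}$ (this determines the weights $\omega_i$ uniquely). Its degree of exactness is the integer $d$ such that $Q_n(p)=I(p)$ for all $p\in\mathcal P_d$ but not for all $p\in\mathcal P_{d+1}$; one has $n-1\le d\le 2n-1$. Polynomials. $\phi_0(x)=1$ and $\phi_j(x)=\phi_{j-1}(x)\,(x-t_j)$ for $1\le j\le n-1$; $q_n(x)=\phi_{n-1}(x)\,(x-t_n)$ and $q_j(x)=q_{j-1}(x)\,(x-t_r)$ for $j\ge n+1$, where $r\in\{1,\ldots,n\}$ and $r\equiv j \pmod n$. Moments. $\mu_i=I(\phi_i)$ for $0\le i\le n-1$. The principal moment of the rule is $\mu_Q=I(q_{d+1})$, where $d$ is the degree of exactness; it is nonzero. Fundamental system. Let $A$ be the $n\times n$ matrix with entries $A_{ij}=\phi_{i-1}(t_j)$, $1\le i,j\le n$ (it is upper triangular with nonzero diagonal entries), and $c=[\mu_0,\ldots,\mu_{n-1}]^T$. The fundamental system of the rule is $Fx=\tilde c$, where $F$ is the $(n+1)\times n$ matrix obtained by appending a zero row at the bottom of $A$, and $\tilde c=[\mu_0,\ldots,\mu_{n-1},\mu_Q]^T\in\mathbb{R}^{n+1}$.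 Norms. $\|x\|_p=(\sum_i|x_i|^p)^{1/p}$ and $\|x\|_\infty=\max_i|x_i|$. *)

theory Defs
  imports "HOL-Analysis.Interval_Integral" "HOL-Computational_Algebra.Polynomial"
    "Jordan_Normal_Form.Matrix"
begin

(* Both Finite_Cartesian_Product and Jordan_Normal_Form use the infix $; here it is
   always the component of a Jordan_Normal_Form vector. *)
unbundle no vec_syntax
notation vec_index (infixl \<open>$\<close> 100)
hide_const (open) Finite_Cartesian_Product.vec
hide_type (open) Finite_Cartesian_Product.vec

text \<open>
  Nodes, weights and the polynomials are numbered as in the mathematics (nodes and weights from 1),
  whereas vectors and matrices of Jordan_Normal_Form are indexed from 0.
\<close>

section \<open>Weighted integral and quadrature rule\<close>

text \<open>The interval may be unbounded, hence the extended real end points.\<close>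

definition weight_function :: "nat \<Rightarrow> ereal \<Rightarrow> ereal \<Rightarrow> (real \<Rightarrow> real) \<Rightarrow> bool" where
  "weight_function n a b w \<longleftrightarrow>
     continuous_on (einterval a b) w \<and>
     (\<forall>x\<in>einterval a b. 0 \<le> w x) \<and>
     (\<exists>x\<in>einterval a b. w x \<noteq> 0) \<and>
     interval_lebesgue_integrable lborel a b w \<and>
     (\<forall>i\<le>2 * n. interval_lebesgue_integrable lborel a b (\<lambda>x. x ^ i * w x))"

definition weighted_integral ::
    "ereal \<Rightarrow> ereal \<Rightarrow> (real \<Rightarrow> real) \<Rightarrow> (real \<Rightarrow> real) \<Rightarrow> real" where
  "weighted_integral a b w f = (LBINT x=a..b. f x * w x)"

definition quadrature ::
    "nat \<Rightarrow> (nat \<Rightarrow> real) \<Rightarrow> (nat \<Rightarrow> real) \<Rightarrow> (real \<Rightarrow> real) \<Rightarrow> real" where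
  "quadrature n t \<omega> f = (\<Sum>i=1..n. \<omega> i * f (t i))"

text \<open>In the following, \<open>I\<close> is the functional being approximated and \<open>Q\<close> the rule.\<close>

definition exact_on_degree ::
    "((real \<Rightarrow> real) \<Rightarrow> real) \<Rightarrow> ((real \<Rightarrow> real) \<Rightarrow> real) \<Rightarrow> nat \<Rightarrow> bool" where
  "exact_on_degree I Q k \<longleftrightarrow> (\<forall>p :: real poly. degree p \<le> k \<longrightarrow> Q (poly p) = I (poly p))"

definition degree_of_exactness ::
    "((real \<Rightarrow> real) \<Rightarrow> real) \<Rightarrow> ((real \<Rightarrow> real) \<Rightarrow> real) \<Rightarrow> nat" where
  "degree_of_exactness I Q =
     (THE d. exact_on_degree I Q d \<and> \<not> exact_on_degree I Q (d + 1))"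

section \<open>Node polynomials, moments and the fundamental system\<close>

primrec phi :: "(nat \<Rightarrow> real) \<Rightarrow> nat \<Rightarrow> real poly" where
  "phi t 0 = 1"
| "phi t (Suc j) = phi t j * [:- t (Suc j), 1:]"

text \<open>
  The polynomials \<open>q\<^sub>j\<close> are meant for \<open>j \<ge> n \<ge> 1\<close> only; smaller indices get arbitrary values.
  For \<open>j \<ge> n\<close> the factor in \<open>q\<^sub>j\<^sub>+\<^sub>1\<close> belongs to the node with index
  \<open>r = j mod n + 1\<close>, the unique element of \<open>{1..n}\<close> congruent to \<open>j + 1\<close> modulo \<open>n\<close>.
\<close>

primrec node_poly :: "nat \<Rightarrow> (nat \<Rightarrow> real) \<Rightarrow> nat \<Rightarrow> real poly" where
  "node_poly n t 0 = 1"
| "node_poly n t (Suc j) =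
     (if Suc j \<le> n then phi t (n - 1) * [:- t n, 1:]
      else node_poly n t j * [:- t (j mod n + 1), 1:])"

definition moment :: "((real \<Rightarrow> real) \<Rightarrow> real) \<Rightarrow> (nat \<Rightarrow> real) \<Rightarrow> nat \<Rightarrow> real" where
  "moment I t i = I (poly (phi t i))"

definition principal_moment ::
    "((real \<Rightarrow> real) \<Rightarrow> real) \<Rightarrow> nat \<Rightarrow> (nat \<Rightarrow> real) \<Rightarrow> (nat \<Rightarrow> real) \<Rightarrow> real" where
  "principal_moment I n t \<omega> =
     I (poly (node_poly n t (degree_of_exactness I (quadrature n t \<omega>) + 1)))"

definition node_matrix :: "nat \<Rightarrow> (nat \<Rightarrow> real) \<Rightarrow> real mat" where
  "node_matrix n t = mat n n (\<lambda>(i, j). poly (phi t i) (t (j + 1)))"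

definition fundamental_matrix :: "nat \<Rightarrow> (nat \<Rightarrow> real) \<Rightarrow> real mat" where
  "fundamental_matrix n t = node_matrix n t @\<^sub>r 0\<^sub>m 1 n"

definition fundamental_rhs ::
    "((real \<Rightarrow> real) \<Rightarrow> real) \<Rightarrow> nat \<Rightarrow> (nat \<Rightarrow> real) \<Rightarrow> (nat \<Rightarrow> real) \<Rightarrow> real vec" where
  "fundamental_rhs I n t \<omega> = vec n (moment I t) @\<^sub>v vec 1 (\<lambda>_. principal_moment I n t \<omega>)"

definition weight_vector :: "nat \<Rightarrow> (nat \<Rightarrow> real) \<Rightarrow> real vec" where
  "weight_vector n \<omega> = vec n (\<lambda>i. \<omega> (i + 1))"

section \<open>Norms, residuals and least squares\<close>

definition p_norm :: "nat \<Rightarrow> real vec \<Rightarrow> real" where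
  "p_norm p v = root p (\<Sum>i<dim_vec v. \<bar>v $ i\<bar> ^ p)"

definition max_norm :: "real vec \<Rightarrow> real" where
  "max_norm v = Max ((\<lambda>i. \<bar>v $ i\<bar>) ` {..<dim_vec v})"

definition residual :: "real mat \<Rightarrow> real vec \<Rightarrow> real vec \<Rightarrow> real vec" where
  "residual M c x = M *\<^sub>v x - c"

definition least_squares_solution :: "real mat \<Rightarrow> real vec \<Rightarrow> real vec \<Rightarrow> bool" where
  "least_squares_solution M c x \<longleftrightarrow>
     is_arg_min (\<lambda>y. p_norm 2 (residual M c y)) (\<lambda>y. y \<in> carrier_vec (dim_col M)) x"

end

theory Submission
  imports Defs
begin

text \<open>
  The extra zero row of \<open>F\<close> contributes the constant \<open>\<mu>\<^sub>Q\<^sup>2\<close> to \<open>\<parallel>F x - c\<parallel>\<^sub>2\<^sup>2\<close>, so minimising it amounts to solving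
  the triangular system given by the first \<open>n\<close> rows. That system is nonsingular because the nodes are
  distinct, and by exactness on polynomials of degree below \<open>n\<close> its solution is \<open>\<omega>\<close>. Hence the residual
  at \<open>\<omega>\<close> is \<open>(0, \<dots>, 0, -\<mu>\<^sub>Q)\<close>.
\<close>

lemma poly_phi: "poly (phi t i) x = (\<Prod>k=1..i. x - t k)"
  by (induction i) (auto simp: algebra_simps)

lemma degree_phi_le: "degree (phi t i) \<le> i"
proof (induction i)
  case (Suc i)
  have "degree (phi t i * [:- t (Suc i), 1:]) \<le> degree (phi t i) + 1"
    using degree_mult_le[of "phi t i" "[:- t (Suc i), 1:]"] by simp
  with Suc show ?case by simp
qed simp

lemma node_matrix_carrier [simp]: "node_matrix n t \<in> carrier_mat n n"
  by (simp add: node_matrix_def)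

text \<open>Rows and columns count from 0 and nodes from 1, so column \<open>j\<close> evaluates at
  the node \<open>t (j + 1)\<close>. For \<open>j < i\<close> this node is a root of
  \<open>phi t i\<close>.\<close>

lemma upper_triangular_node_matrix: "upper_triangular (node_matrix n t)"
proof -
  have "poly (phi t i) (t (j + 1)) = 0" if "j < i" for i j
    using that by (auto simp: poly_phi)
  then show ?thesis
    by (simp add: upper_triangular_def node_matrix_def)
qed

text \<open>The diagonal entry is the product of the differences \<open>t (i + 1) - t k\<close> over
  the earlier nodes.\<close>

lemma node_matrix_diag_nonzero:
  assumes "inj_on t {1..n}" and "i < n"
  shows "node_matrix n t $$ (i, i) \<noteq> 0"
proof -
  have "t (i + 1) \<noteq> t k" if "k \<in> {1..i}" for k
    using inj_on_eq_iff[OF assms(1), of "i + 1" k] that assms(2) by simp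
  then show ?thesis
    using assms(2) by (simp add: node_matrix_def poly_phi)
qed

text \<open>Back substitution, phrased with an extremal index: in the row of the last nonzero
  component of \<open>y\<close>, the terms to the left vanish by triangularity and those to the
  right by maximality. Only the diagonal term survives, and it is nonzero.\<close>

lemma upper_triangular_mult_vec_eq_0:
  fixes A :: "'a :: idom mat"
  assumes A: "A \<in> carrier_mat n n" "upper_triangular A"
    and diag: "\<And>i. i < n \<Longrightarrow> A $$ (i, i) \<noteq> 0"
    and y: "y \<in> carrier_vec n" "A *\<^sub>v y = 0\<^sub>v n"
  shows "y = 0\<^sub>v n"
proof (rule ccontr)
  assume "y \<noteq> 0\<^sub>v n"
  define S where "S = {j. j < n \<and> y $ j \<noteq> 0}"
  have "S \<noteq> {}"
    using y \<open>y \<noteq> 0\<^sub>v n\<close> by (auto simp: S_def)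
  moreover have "finite S"
    by (simp add: S_def)
  ultimately have m: "Max S < n" "y $ Max S \<noteq> 0" and above: "\<And>j. j < n \<Longrightarrow> Max S < j \<Longrightarrow> y $ j = 0"
    using Max_in[of S] Max_ge[of S] by (auto simp: S_def leD)
  have zero: "A $$ (Max S, j) * y $ j = 0" if "j < n" "j \<noteq> Max S" for j
    using that above[of j] A m by (cases j "Max S" rule: linorder_cases) auto
  have "(A *\<^sub>v y) $ Max S = (\<Sum>j\<in>{0..<n}. A $$ (Max S, j) * y $ j)"
    using A y(1) m by (simp add: scalar_prod_def)
  also have "\<dots> = (\<Sum>j\<in>{Max S}. A $$ (Max S, j) * y $ j)"
    using m zero by (intro sum.mono_neutral_right) auto
  finally show False
    using y(2) m diag by simp
qed

text \<open>Row \<open>i\<close> of the product is the rule applied to \<open>phi t i\<close>, whose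
  degree is at most \<open>n - 1\<close>, so exactness turns it into the moment.\<close>

lemma node_matrix_mult_weights:
  assumes "1 \<le> n" and "exact_on_degree I (quadrature n t \<omega>) (n - 1)"
  shows "node_matrix n t *\<^sub>v weight_vector n \<omega> = vec n (moment I t)"
proof (rule eq_vecI)
  fix i
  assume "i < dim_vec (vec n (moment I t))"
  then have i: "i < n" by simp
  have "(node_matrix n t *\<^sub>v weight_vector n \<omega>) $ i
      = (\<Sum>j\<in>{0..<n}. \<omega> (j + 1) * poly (phi t i) (t (j + 1)))"
    using i by (simp add: node_matrix_def weight_vector_def scalar_prod_def mult.commute)
  also have "\<dots> = quadrature n t \<omega> (poly (phi t i))"
    unfolding quadrature_def
    \<comment> \<open>The shift passes from vector indices 0 to n - 1 to node numbers 1 to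
      n.\<close>
    by (rule sum.reindex_bij_witness[of _ "\<lambda>k. k - 1" "\<lambda>j. j + 1"]) auto
  also have "\<dots> = moment I t i"
    using assms i degree_phi_le[of t i] by (auto simp: exact_on_degree_def moment_def)
  finally show "(node_matrix n t *\<^sub>v weight_vector n \<omega>) $ i = vec n (moment I t) $ i"
    using i by simp
qed (simp add: node_matrix_def)

lemma residual_append_zero_row:
  assumes "A \<in> carrier_mat m n" "b \<in> carrier_vec m" "x \<in> carrier_vec n"
  shows "residual (A @\<^sub>r 0\<^sub>m 1 n) (b @\<^sub>v vec 1 (\<lambda>_. e)) x = (A *\<^sub>v x - b) @\<^sub>v vec 1 (\<lambda>_. - e)"
proof -
  have "(A @\<^sub>r 0\<^sub>m 1 n) *\<^sub>v x = (A *\<^sub>v x) @\<^sub>v (0\<^sub>m 1 n *\<^sub>v x)"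
    using assms by (intro mat_mult_append) auto
  then show ?thesis
    using assms by (intro eq_vecI) (auto simp: residual_def)
qed

lemma p_norm_append_single:
  "p_norm p (v @\<^sub>v vec 1 (\<lambda>_. e)) = root p ((\<Sum>i<dim_vec v. \<bar>v $ i\<bar> ^ p) + \<bar>e\<bar> ^ p)"
  by (simp add: p_norm_def)

text \<open>The case \<open>p = 0\<close> must be excluded, because \<open>root 0\<close> is
  constantly 0.\<close>

lemma p_norm_zero_append_single:
  assumes "1 \<le> p"
  shows "p_norm p (0\<^sub>v n @\<^sub>v vec 1 (\<lambda>_. e)) = \<bar>e\<bar>"
  using assms by (simp add: p_norm_append_single power_0_left real_root_power_cancel del: One_nat_def)

lemma max_norm_zero_append_single: "max_norm (0\<^sub>v n @\<^sub>v vec 1 (\<lambda>_. e)) = \<bar>e\<bar>"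
proof -
  let ?v = "0\<^sub>v n @\<^sub>v vec 1 (\<lambda>_. e)"
  have "\<bar>?v $ i\<bar> \<le> \<bar>e\<bar>" if "i < dim_vec ?v" for i
    using that by simp
  moreover have "\<bar>e\<bar> = \<bar>?v $ n\<bar>" and "n < dim_vec ?v"
    by simp_all
  ultimately show ?thesis
    unfolding max_norm_def by (intro Max_eqI) (auto simp del: index_append_vec)
qed

text \<open>The entry \<open>e\<close> alone already contributes \<open>e\<^sup>2\<close> under the
  root, which leaves no room for the squares of the entries of \<open>v\<close>.\<close>

lemma p_norm_2_append_single_le_iff:
  "p_norm 2 (v @\<^sub>v vec 1 (\<lambda>_. e)) \<le> \<bar>e\<bar> \<longleftrightarrow> v = 0\<^sub>v (dim_vec v)"
proof -
  have "p_norm 2 (v @\<^sub>v vec 1 (\<lambda>_. e)) \<le> \<bar>e\<bar> \<longleftrightarrow> (\<Sum>i<dim_vec v. (v $ i)\<^sup>2) \<le> 0"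
    using real_sqrt_le_iff[of "(\<Sum>i<dim_vec v. (v $ i)\<^sup>2) + e\<^sup>2" "e\<^sup>2"]
    by (simp add: p_norm_append_single sqrt_def[symmetric] del: One_nat_def)
  also have "\<dots> \<longleftrightarrow> (\<forall>i<dim_vec v. v $ i = 0)"
    using sum_nonneg_eq_0_iff[of "{..<dim_vec v}" "\<lambda>i. (v $ i)\<^sup>2"]
      sum_nonneg[of "{..<dim_vec v}" "\<lambda>i. (v $ i)\<^sup>2"]
    by force
  also have "\<dots> \<longleftrightarrow> v = 0\<^sub>v (dim_vec v)"
    by (metis eq_vecI index_zero_vec)
  finally show ?thesis .
qed

text \<open>A point \<open>x\<close> that reaches the lower bound \<open>m\<close> reduces
  minimality, a comparison with all points, to one inequality.\<close>

lemma is_arg_min_iff_le: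
  fixes f :: "'a \<Rightarrow> 'b :: linorder"
  assumes "P x" "f x \<le> m" "\<And>z. P z \<Longrightarrow> m \<le> f z"
  shows "is_arg_min f P y \<longleftrightarrow> P y \<and> f y \<le> m"
  using assms order.trans unfolding is_arg_min_linorder by blast

text \<open>Writing the upper block of the right-hand side as \<open>A *\<^sub>v x\<close> makes the
  first \<open>m\<close> equations solvable. The lower bound \<open>\<bar>e\<bar>\<close> on the
  norm is then attained, exactly at their solutions.\<close>

lemma least_squares_append_zero_row:
  assumes A: "A \<in> carrier_mat m n" and x: "x \<in> carrier_vec n"
    and y: "y \<in> carrier_vec n"
  shows "least_squares_solution (A @\<^sub>r 0\<^sub>m 1 n) ((A *\<^sub>v x) @\<^sub>v vec 1 (\<lambda>_. e)) y
    \<longleftrightarrow> A *\<^sub>v y = A *\<^sub>v x"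
proof -
  let ?N = "\<lambda>z. p_norm 2 (residual (A @\<^sub>r 0\<^sub>m 1 n) ((A *\<^sub>v x) @\<^sub>v vec 1 (\<lambda>_. e)) z)"
  have dim: "dim_col (A @\<^sub>r 0\<^sub>m 1 n) = n"
    using A by (auto simp: append_rows_def)
  have le_iff: "?N z \<le> \<bar>e\<bar> \<longleftrightarrow> A *\<^sub>v z = A *\<^sub>v x" if z: "z \<in> carrier_vec n" for z
  proof -
    have "?N z \<le> \<bar>e\<bar> \<longleftrightarrow> A *\<^sub>v z - A *\<^sub>v x = 0\<^sub>v m"
      using p_norm_2_append_single_le_iff[of "A *\<^sub>v z - A *\<^sub>v x" "- e"] A x z
      by (simp add: residual_append_zero_row[OF A] del: One_nat_def)
    also have "\<dots> \<longleftrightarrow> A *\<^sub>v z = A *\<^sub>v x"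
      using A by (auto simp: vec_eq_iff)
    finally show ?thesis .
  qed
  have ge: "\<bar>e\<bar> \<le> ?N z" if z: "z \<in> carrier_vec n" for z
    using A x z real_root_le_mono[of 2 "e\<^sup>2" "(\<Sum>i<m. ((A *\<^sub>v z - A *\<^sub>v x) $ i)\<^sup>2) + e\<^sup>2"]
    by (simp add: residual_append_zero_row[OF A] p_norm_append_single sum_nonneg sqrt_def[symmetric] del: One_nat_def)
  have "?N x \<le> \<bar>e\<bar>"
    using le_iff[OF x] by simp
  then have "least_squares_solution (A @\<^sub>r 0\<^sub>m 1 n) ((A *\<^sub>v x) @\<^sub>v vec 1 (\<lambda>_. e)) y
      \<longleftrightarrow> y \<in> carrier_vec n \<and> ?N y \<le> \<bar>e\<bar>"
    unfolding least_squares_solution_def dim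
    by (rule is_arg_min_iff_le[where P = "\<lambda>z. z \<in> carrier_vec n", OF x _ ge])
  then show ?thesis
    using y le_iff[OF y] by blast
qed

theorem proposition2p1:
  fixes n :: nat
    and a b :: ereal
    and w :: "real \<Rightarrow> real"
    and t \<omega> :: "nat \<Rightarrow> real"
  defines "I \<equiv> weighted_integral a b w"
  defines "\<mu>Q \<equiv> principal_moment I n t \<omega>"
  defines "F \<equiv> fundamental_matrix n t"
  defines "c \<equiv> fundamental_rhs I n t \<omega>"
  defines "r \<equiv> residual F c"
  assumes "n \<ge> 1"
    and "a < b"
    and "weight_function n a b w"
    and "strict_mono_on {1..n} t"
    and "exact_on_degree I (quadrature n t \<omega>) (n - 1)"
  shows "(least_squares_solution F c (weight_vector n \<omega>)
            \<and> (\<forall>x. least_squares_solution F c x \<longrightarrow> x = weight_vector n \<omega>))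
       \<and> (max_norm (r (weight_vector n \<omega>)) = \<bar>\<mu>Q\<bar>
            \<and> (\<forall>p\<ge>1. p_norm p (r (weight_vector n \<omega>)) = \<bar>\<mu>Q\<bar>))"
proof -
  let ?A = "node_matrix n t" and ?\<omega> = "weight_vector n \<omega>"
  have \<omega>: "?\<omega> \<in> carrier_vec n"
    by (simp add: weight_vector_def)
  have A\<omega>: "?A *\<^sub>v ?\<omega> = vec n (moment I t)"
    using assms by (intro node_matrix_mult_weights) auto
  have F: "F = ?A @\<^sub>r 0\<^sub>m 1 n"
    by (simp add: F_def fundamental_matrix_def)
  \<comment> \<open>The moments are replaced by their value as a matrix-vector product, which
    exhibits the weights as a solution of the upper block.\<close>
  have c: "c = (?A *\<^sub>v ?\<omega>) @\<^sub>v vec 1 (\<lambda>_. \<mu>Q)"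
    by (simp add: c_def fundamental_rhs_def \<mu>Q_def A\<omega>)
  have least: "least_squares_solution F c x \<longleftrightarrow> ?A *\<^sub>v x = ?A *\<^sub>v ?\<omega>" if "x \<in> carrier_vec n" for x
    unfolding F c using \<omega> that by (intro least_squares_append_zero_row[OF node_matrix_carrier])
  have unique: "x = ?\<omega>" if "least_squares_solution F c x" for x
  proof -
    \<comment> \<open>The dimension of \<open>x\<close> comes from the domain of minimisation, the
      vectors of length \<open>dim_col F\<close>.\<close>
    have x: "x \<in> carrier_vec n"
      using that by (auto simp: least_squares_solution_def is_arg_min_def F append_rows_def node_matrix_def)
    \<comment> \<open>Two minimizers have the same image under the node matrix, so their difference
      lies in its kernel, which is trivial because the nodes are distinct.\<close>
    have "?A *\<^sub>v (x - ?\<omega>) = ?A *\<^sub>v x - ?A *\<^sub>v ?\<omega>"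
      using x \<omega> by (intro mult_minus_distrib_mat_vec[OF node_matrix_carrier])
    also have "\<dots> = 0\<^sub>v n"
      using least[OF x] that by (simp add: A\<omega>)
    finally have "?A *\<^sub>v (x - ?\<omega>) = 0\<^sub>v n" .
    then have "x - ?\<omega> = 0\<^sub>v n"
      using x \<omega> node_matrix_diag_nonzero[OF strict_mono_on_imp_inj_on[OF \<open>strict_mono_on {1..n} t\<close>]]
      by (metis upper_triangular_mult_vec_eq_0 node_matrix_carrier upper_triangular_node_matrix
          minus_carrier_vec)
    then show ?thesis
      using x \<omega> by (auto simp: vec_eq_iff)
  qed
  have "r ?\<omega> = 0\<^sub>v n @\<^sub>v vec 1 (\<lambda>_. - \<mu>Q)"
    unfolding r_def F c using \<omega> A\<omega> by (simp add: residual_append_zero_row[OF node_matrix_carrier] del: One_nat_def)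
  then have "max_norm (r ?\<omega>) = \<bar>\<mu>Q\<bar> \<and> (\<forall>p\<ge>1. p_norm p (r ?\<omega>) = \<bar>\<mu>Q\<bar>)"
    by (simp add: p_norm_zero_append_single max_norm_zero_append_single del: One_nat_def)
  with least[OF \<omega>] unique show ?thesis
    by blast
qed

end
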